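(* Let $A$ and $B$ be nonempty finite subsets of an abelian group $G$, with $|A|=|B|$ and $1 \notin B$. Then $\delta(A,B)$ equals the maximum value of $$|S|-|B \setminus R|,$$ where $S$ and $R$ range over all subsets of $A$ and $B \cup\{1\}$, respectively, such that $SR = S$.
   Context: The group $G$ is written multiplicatively with identity $1$. For subsets $S,T \subseteq G$, $ST = \{st : s \in S,\ t \in T\}$ (so $ST = \emptyset$ if $S$ or $T$ is empty). For nonempty finite $A,B \subseteq G$ with $|A|=|B|$, a partial matching of $(A,B)$ with defect $d$ is an injective map $f : A' \to B$, where $A' \subseteq A$ and $|A \setminus A'| = d$, such that $a f(a) \notin A$ for all $a \in A'$. The empty map (with $A' = \emptyset$) is allowed. The deficiency $\delta(A,B)$ is the smallest nonnegative integer $d$ such that $(A,B)$ has a partial matching with defect $d$. *)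

theory Defs
  imports "HOL-Algebra.Coset"
begin

definition partial_matching ::
  "('a, 'b) monoid_scheme \<Rightarrow> 'a set \<Rightarrow> 'a set \<Rightarrow> 'a set \<Rightarrow> ('a \<Rightarrow> 'a) \<Rightarrow> nat \<Rightarrow> bool"
where
  "partial_matching G A B A' f d \<longleftrightarrow>
     A' \<subseteq> A \<and> card (A - A') = d \<and>
     inj_on f A' \<and> f ` A' \<subseteq> B \<and>
     (\<forall>a\<in>A'. a \<otimes>\<^bsub>G\<^esub> f a \<notin> A)"

(* For finite A the minimum is over a nonempty set: A' = {} gives defect card A. *)
definition deficiency :: "('a, 'b) monoid_scheme \<Rightarrow> 'a set \<Rightarrow> 'a set \<Rightarrow> nat" where
  "deficiency G A B = (LEAST d. \<exists>A' f. partial_matching G A B A' f d)"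

end

(* Two ingredients. The deficiency version of Hall's theorem turns the deficiency into the maximum
   of |S| - |B - U| where U is the set of all b in B with Sb contained in A. Then the Dyson transform
   (S, R) -> (S Un eR, R Int e^-1 S), for e in S, keeps |S| + |R| and does not enlarge the product
   set; iterated until it is stationary for all e in S, it yields a pair with SR = S. *)
theory Submission
  imports Defs
begin

(* Rado's argument: if some N i contains x and y with x \<noteq> y, then by submodularity of S \<mapsto> card (N S)
   at least one of the two can be deleted without violating the hypothesis. *)
lemma hall_defect:
  fixes N :: "'i \<Rightarrow> 'x set"
  assumes "finite I" "\<And>i. i \<in> I \<Longrightarrow> finite (N i)"
    and "\<And>S. S \<subseteq> I \<Longrightarrow> card S \<le> card (\<Union> (N ` S)) + d"
  shows "\<exists>J f. J \<subseteq> I \<and> inj_on f J \<and> (\<forall>i\<in>J. f i \<in> N i) \<and> card (I - J) \<le> d"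
  using assms(2,3)
proof (induction "\<Sum>i\<in>I. card (N i)" arbitrary: N rule: less_induct)
  case less
  note finN = less.prems(1) and hall = less.prems(2)
  show ?case
  proof (cases "\<exists>i\<in>I. \<exists>x\<in>N i. \<exists>y\<in>N i. x \<noteq> y")
    case True
    then obtain i x y where i: "i \<in> I" and xy: "x \<in> N i" "y \<in> N i" "x \<noteq> y" by blast
    define D where "D z = N(i := N i - {z})" for z
    have sub: "D z j \<subseteq> N j" for z j by (auto simp: D_def)
    have reduce: ?thesis if z: "z \<in> N i"
      and ok: "\<And>S. S \<subseteq> I \<Longrightarrow> card S \<le> card (\<Union> (D z ` S)) + d" for z
    proof -
      have "(\<Sum>j\<in>I. card (D z j)) < (\<Sum>j\<in>I. card (N j))"
      proof (rule sum_strict_mono_ex1)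
        show "\<forall>j\<in>I. card (D z j) \<le> card (N j)"
          using sub finN by (blast intro: card_mono)
        show "\<exists>j\<in>I. card (D z j) < card (N j)"
          using i card_Diff1_less[OF finN[OF i] z] by (intro bexI[of _ i]) (simp_all add: D_def)
      qed (fact assms(1))
      moreover have "finite (D z j)" if "j \<in> I" for j
        using finN[OF that] sub finite_subset by blast
      ultimately obtain J f where "J \<subseteq> I" "inj_on f J" "\<forall>j\<in>J. f j \<in> D z j" "card (I - J) \<le> d"
        using less.hyps[of "D z"] ok by blast
      then show ?thesis using sub by blast
    qed
    have "(\<forall>S\<subseteq>I. card S \<le> card (\<Union> (D x ` S)) + d) \<or> (\<forall>S\<subseteq>I. card S \<le> card (\<Union> (D y ` S)) + d)"
    proof (rule ccontr)
      assume "\<not> ?thesis"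
      then obtain S T where S: "S \<subseteq> I" "card (\<Union> (D x ` S)) + d < card S"
        and T: "T \<subseteq> I" "card (\<Union> (D y ` T)) + d < card T"
        by (meson not_le)
      \<comment> \<open>A violation must involve \<open>i\<close>: away from \<open>i\<close> the
        families \<open>D z\<close> and \<open>N\<close> agree, and \<open>N\<close> satisfies the
        hypothesis.\<close>
      have D_eq: "D z ` U = N ` U" if "i \<notin> U" for z U
        using that by (auto simp: D_def image_iff)
      have iS: "i \<in> S" using S hall[OF S(1)] D_eq[of S x] by force
      have iT: "i \<in> T" using T hall[OF T(1)] D_eq[of T y] by force
      have fin: "finite (\<Union> (D z ` U))" if "U \<subseteq> I" for z U
      proof (rule finite_subset)
        show "\<Union> (D z ` U) \<subseteq> \<Union> (N ` I)" using sub that by blast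
        show "finite (\<Union> (N ` I))" using assms(1) finN by blast
      qed
      have fS: "finite S" "finite T"
        using S(1) T(1) assms(1) by (simp_all add: finite_subset)
      \<comment> \<open>Nothing of \<open>N i\<close> is lost on the right: \<open>i\<close> lies in
        both \<open>S\<close> and \<open>T\<close>, and since \<open>x \<noteq> y\<close>, each
        element of \<open>N i\<close> survives in \<open>D x i\<close> or in
        \<open>D y i\<close>.\<close>
      have "\<Union> (N ` (S \<union> T)) \<subseteq> \<Union> (D x ` S) \<union> \<Union> (D y ` T)"
        using iS iT xy(3) by (fastforce simp: D_def split: if_splits)
      then have 1: "card (\<Union> (N ` (S \<union> T))) \<le> card (\<Union> (D x ` S) \<union> \<Union> (D y ` T))"
        using fin S(1) T(1) by (intro card_mono) auto
      have "\<Union> (N ` (S \<inter> T - {i})) \<subseteq> \<Union> (D x ` S) \<inter> \<Union> (D y ` T)"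
        by (fastforce simp: D_def)
      then have 2: "card (\<Union> (N ` (S \<inter> T - {i}))) \<le> card (\<Union> (D x ` S) \<inter> \<Union> (D y ` T))"
        using fin S(1) by (intro card_mono) auto
      have 3: "card (\<Union> (D x ` S)) + card (\<Union> (D y ` T)) =
          card (\<Union> (D x ` S) \<union> \<Union> (D y ` T)) + card (\<Union> (D x ` S) \<inter> \<Union> (D y ` T))"
        using fin S(1) T(1) by (intro card_Un_Int) auto
      have 4: "card S + card T = card (S \<union> T) + card (S \<inter> T)"
        using fS by (rule card_Un_Int)
      \<comment> \<open>Leaving \<open>i\<close> out of the intersection costs 1, whereas the two
        strict violations for \<open>S\<close> and \<open>T\<close> together give a surplus of 2;
        this is the contradiction.\<close>
      have 5: "card (S \<inter> T) = Suc (card (S \<inter> T - {i}))"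
        using iS iT fS by (metis IntI card.remove finite_Int)
      have 6: "card (S \<union> T) \<le> card (\<Union> (N ` (S \<union> T))) + d" using S T by (intro hall) auto
      have 7: "card (S \<inter> T - {i}) \<le> card (\<Union> (N ` (S \<inter> T - {i}))) + d"
        using S by (intro hall) auto
      show False using 1 2 3 4 5 6 7 S(2) T(2) by linarith
    qed
    then show ?thesis using reduce xy by blast
  next
    case False
    \<comment> \<open>Every \<open>N i\<close> now has at most one element, so an index
      \<open>g x\<close> chosen for \<open>x\<close> determines \<open>x\<close>. The inverse of
      \<open>g\<close> is the required map, and the hypothesis for \<open>I\<close> itself bounds
      the number of indices missed.\<close>
    have "\<exists>j. j \<in> I \<and> x \<in> N j" if "x \<in> \<Union> (N ` I)" for x using that by blast
    then obtain g where g: "\<And>x. x \<in> \<Union> (N ` I) \<Longrightarrow> g x \<in> I \<and> x \<in> N (g x)" by metis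
    let ?X = "\<Union> (N ` I)"
    have inj: "inj_on g ?X" using g False by (metis inj_onI)
    have sub: "g ` ?X \<subseteq> I" using g by blast
    have "card (I - g ` ?X) = card I - card ?X"
      using card_Diff_subset[OF finite_subset[OF sub assms(1)] sub] card_image[OF inj] by simp
    moreover have "inj_on (inv_into ?X g) (g ` ?X)" by (simp add: inj_on_inv_into)
    moreover have "\<forall>i\<in>g ` ?X. inv_into ?X g i \<in> N i"
      using g inj by (metis (no_types, lifting) imageE inv_into_f_f)
    ultimately show ?thesis using hall[of I] sub
      by (intro exI[of _ "g ` ?X"] exI[of _ "inv_into ?X g"]) auto
  qed
qed

text \<open>If \<open>S <#> R\<close> is not contained in \<open>S\<close>, some
  \<open>e \<otimes> r\<close> lies outside \<open>S\<close>; the Dyson transform at this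
  \<open>e\<close> discards \<open>r\<close>, so \<open>R\<close> shrinks strictly and the iteration
  ends. The identity stays in \<open>R\<close> because \<open>e\<close> is taken from
  \<open>S\<close>, and it turns the final inclusion into an equality.\<close>

lemma (in comm_group) dyson_transform_stationary:
  assumes "finite S" "finite R" "S \<subseteq> carrier G" "R \<subseteq> carrier G" "\<one> \<in> R"
  shows "\<exists>S' R'. S' \<subseteq> S <#> R \<and> R' \<subseteq> R \<and> \<one> \<in> R' \<and> S' <#> R' = S' \<and>
    card S' + card R' = card S + card R"
  using assms
proof (induction "card R" arbitrary: S R rule: less_induct)
  case less
  note S = \<open>finite S\<close> \<open>S \<subseteq> carrier G\<close> and R = \<open>finite R\<close> \<open>R \<subseteq> carrier G\<close> \<open>\<one> \<in> R\<close>
  have S_sub: "S \<subseteq> S <#> R"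
    using S(2) R(3) by (force simp: set_mult_def)
  show ?case
  proof (cases "S <#> R \<subseteq> S")
    case True
    with S_sub have "S <#> R = S" by blast
    then show ?thesis using R by (intro exI[of _ S] exI[of _ R]) auto
  next
    case False
    then obtain e r where e: "e \<in> S" and r: "r \<in> R" "e \<otimes> r \<notin> S"
      unfolding set_mult_def by blast
    have ec: "e \<in> carrier G" using e S by blast
    define T where "T = S \<union> (\<otimes>) e ` R"
    define Q where "Q = {x \<in> R. e \<otimes> x \<in> S}"
    have inj: "inj_on ((\<otimes>) e) R"
      using R(2) ec by (simp add: inj_on_def subset_iff)
    have QR: "Q \<subset> R" using r by (auto simp: Q_def)
    \<comment> \<open>The overlap is a translate of \<open>Q\<close>, so \<open>S\<close> gains
      exactly as many elements as \<open>R\<close> loses.\<close>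
    have "S \<inter> (\<otimes>) e ` R = (\<otimes>) e ` Q" by (auto simp: Q_def)
    moreover have "card ((\<otimes>) e ` Q) = card Q"
      using QR inj by (meson card_image inj_on_subset psubset_imp_subset)
    ultimately have card_eq: "card T + card Q = card S + card R"
      using card_Un_Int[of S "(\<otimes>) e ` R"] S R card_image[OF inj] by (simp add: T_def)
    have "card Q < card R" using QR R by (simp add: psubset_card_mono)
    moreover have "finite T" "finite Q" "T \<subseteq> carrier G" "Q \<subseteq> carrier G" "\<one> \<in> Q"
      using S R ec e by (auto simp: T_def Q_def)
    ultimately have "\<exists>S' R'. S' \<subseteq> T <#> Q \<and> R' \<subseteq> Q \<and> \<one> \<in> R' \<and> S' <#> R' = S' \<and>
        card S' + card R' = card T + card Q"
      by (rule less.hyps)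
    then obtain S' R' where IH: "S' \<subseteq> T <#> Q" "R' \<subseteq> Q" "\<one> \<in> R'" "S' <#> R' = S'"
      "card S' + card R' = card T + card Q"
      by blast
    have "T <#> Q \<subseteq> S <#> R"
    proof
      fix z assume "z \<in> T <#> Q"
      then obtain t q where z: "z = t \<otimes> q" "t \<in> T" "q \<in> Q" unfolding set_mult_def by blast
      consider "t \<in> S" | x where "x \<in> R" "t = e \<otimes> x" using z by (auto simp: T_def)
      then show "z \<in> S <#> R"
      proof cases
        case 1
        then show ?thesis using z QR unfolding set_mult_def by blast
      next
        case 2
        \<comment> \<open>Commutativity lets \<open>x\<close> and \<open>q\<close> trade places:
          \<open>e \<otimes> q\<close> is in \<open>S\<close> by the choice of \<open>Q\<close>, and
          \<open>x\<close> serves as the factor from \<open>R\<close>.\<close>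
        have "q \<in> carrier G" "x \<in> carrier G" using 2 z R QR by auto
        then have "z = (e \<otimes> q) \<otimes> x" using z 2 ec by (simp add: m_ac)
        moreover have "e \<otimes> q \<in> S" using z by (simp add: Q_def)
        ultimately show ?thesis using 2 unfolding set_mult_def by blast
      qed
    qed
    then show ?thesis using IH QR card_eq
      by (intro exI[of _ S'] exI[of _ R']) auto
  qed
qed

lemma deficiency_le:
  assumes "partial_matching G A B A' f d" shows "deficiency G A B \<le> d"
  unfolding deficiency_def using assms by (blast intro: Least_le)

lemma partial_matching_deficiency:
  obtains A' f where "partial_matching G A B A' f (deficiency G A B)"
proof -
  have "partial_matching G A B {} f (card A)" for f
    by (simp add: partial_matching_def)
  then have "\<exists>d A' f. partial_matching G A B A' f d" by blast
  from LeastI_ex[OF this] show ?thesis using that unfolding deficiency_def by blast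
qed

text \<open>An element \<open>a\<close> of \<open>S\<close> cannot be matched into \<open>R\<close>,
  since the product would lie in \<open>S\<close> and hence in \<open>A\<close>. So an optimal
  matching sends the matched part of \<open>S\<close> injectively into \<open>B - R\<close>, and the
  rest of \<open>S\<close> is counted by the defect.\<close>

lemma card_le_deficiency:
  assumes "finite A" "finite B" "S \<subseteq> A" "S <#>\<^bsub>G\<^esub> R = S"
  shows "card S \<le> card (B - R) + deficiency G A B"
proof -
  obtain A' f where f: "partial_matching G A B A' f (deficiency G A B)"
    by (rule partial_matching_deficiency)
  have "f a \<in> B - R" if "a \<in> S \<inter> A'" for a
    using f that assms(3,4) unfolding partial_matching_def set_mult_def by blast
  moreover have "inj_on f (S \<inter> A')"
    using f unfolding partial_matching_def by (meson inf_le2 inj_on_subset)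
  ultimately have "card (S \<inter> A') \<le> card (B - R)"
    using assms(2) by (intro card_inj_on_le[of f]) auto
  moreover have "card S \<le> card (S \<inter> A') + card (A - A')"
  proof -
    have "card S \<le> card ((S \<inter> A') \<union> (A - A'))"
      using assms by (intro card_mono) (auto intro: finite_subset)
    then show ?thesis using card_Un_le order_trans by blast
  qed
  ultimately show ?thesis using f unfolding partial_matching_def by linarith
qed

text \<open>The reverse estimate: Hall's condition concerns every \<open>S \<subseteq> A\<close>,
  but the bound is given only for stationary pairs. The Dyson transform carries it over to all
  \<open>S\<close>.\<close>

lemma deficiency_le_of_card_le:
  assumes "comm_group G" "A \<subseteq> carrier G" "B \<subseteq> carrier G" "finite A" "finite B" "\<one>\<^bsub>G\<^esub> \<notin> B"
    and bound: "\<And>S R. S \<subseteq> A \<Longrightarrow> R \<subseteq> B \<union> {\<one>\<^bsub>G\<^esub>} \<Longrightarrow> S <#>\<^bsub>G\<^esub> R = S \<Longrightarrow> card S \<le> card (B - R) + d"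
  shows "deficiency G A B \<le> d"
proof -
  interpret comm_group G by fact
  define N where "N a = {b \<in> B. a \<otimes>\<^bsub>G\<^esub> b \<notin> A}" for a
  \<comment> \<open>As the identity is in \<open>R\<close> but not in \<open>B\<close>,
    \<open>card (B - R)\<close> is a constant minus \<open>card R\<close>. Hence preserving
    \<open>card S + card R\<close> preserves \<open>card S - card (B - R)\<close>, taken as an
    integer.\<close>
  have card_diff: "card (B - R) + card R = Suc (card B)"
    if R: "R \<subseteq> B \<union> {\<one>\<^bsub>G\<^esub>}" "\<one>\<^bsub>G\<^esub> \<in> R" for R
  proof -
    have "finite R" using R(1) assms(5) by (auto intro: finite_subset)
    then have "card ((B - R) \<union> R) = card (B - R) + card R"
      using assms(5) by (intro card_Un_disjoint) auto
    moreover have "(B - R) \<union> R = insert \<one>\<^bsub>G\<^esub> B" using R by auto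
    ultimately show ?thesis using assms(5,6) by simp
  qed
  have hall: "card S \<le> card (\<Union> (N ` S)) + d" if S: "S \<subseteq> A" for S
  proof -
    \<comment> \<open>The largest \<open>R\<close> within \<open>B\<close> and the identity whose
      product with \<open>S\<close> stays in \<open>A\<close>; its complement in \<open>B\<close> is
      the set of all admissible partners of elements of \<open>S\<close>.\<close>
    define R where "R = insert \<one>\<^bsub>G\<^esub> {b \<in> B. \<forall>a\<in>S. a \<otimes>\<^bsub>G\<^esub> b \<in> A}"
    have NR: "\<Union> (N ` S) = B - R" using assms(6) by (auto simp: N_def R_def)
    have R: "R \<subseteq> B \<union> {\<one>\<^bsub>G\<^esub>}" "\<one>\<^bsub>G\<^esub> \<in> R" by (auto simp: R_def)
    have SR_A: "S <#>\<^bsub>G\<^esub> R \<subseteq> A" using S assms(2) by (auto simp: R_def set_mult_def subset_iff)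
    have "finite S" "finite R" "S \<subseteq> carrier G" "R \<subseteq> carrier G"
      using S assms R(1) by (auto intro: finite_subset)
    then obtain S' R' where S': "S' \<subseteq> S <#>\<^bsub>G\<^esub> R"
      and SR: "R' \<subseteq> R" "\<one>\<^bsub>G\<^esub> \<in> R'" "S' <#>\<^bsub>G\<^esub> R' = S'"
      and eq: "card S' + card R' = card S + card R"
      using dyson_transform_stationary[of S R] R(2) by auto
    have R': "R' \<subseteq> B \<union> {\<one>\<^bsub>G\<^esub>}" using SR(1) R(1) by (rule subset_trans)
    show ?thesis
      using bound[OF subset_trans[OF S' SR_A] R' SR(3)] eq card_diff[OF R' SR(2)] card_diff[OF R] NR by simp
  qed
  have "finite (N a)" for a using assms(5) by (simp add: N_def)
  then obtain J f where "J \<subseteq> A" "inj_on f J" "\<forall>a\<in>J. f a \<in> N a" "card (A - J) \<le> d"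
    using hall_defect[of A N d] hall assms(4) by blast
  then have "partial_matching G A B J f (card (A - J))"
    by (auto simp: partial_matching_def N_def)
  from deficiency_le[OF this] \<open>card (A - J) \<le> d\<close> show ?thesis by simp
qed

theorem corollary3p5:
  fixes G :: "('a, 'b) monoid_scheme" and A B :: "'a set"
  assumes "comm_group G"
    and "A \<subseteq> carrier G" and "B \<subseteq> carrier G"
    and "finite A" and "finite B"
    and "A \<noteq> {}" and "B \<noteq> {}"
    and "card A = card B"
    and "\<one>\<^bsub>G\<^esub> \<notin> B"
  shows "int (deficiency G A B) =
    Max {int (card S) - int (card (B - R)) | S R.
           S \<subseteq> A \<and> R \<subseteq> B \<union> {\<one>\<^bsub>G\<^esub>} \<and> S <#>\<^bsub>G\<^esub> R = S}"
    (is "_ = Max ?V")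
proof (rule antisym)
  have "?V \<subseteq> (\<lambda>(S, R). int (card S) - int (card (B - R))) ` (Pow A \<times> Pow (B \<union> {\<one>\<^bsub>G\<^esub>}))"
    by auto
  then have fin: "finite ?V" by (rule finite_subset) (use assms(4,5) in simp)
  have "{} <#>\<^bsub>G\<^esub> B = {}" by (simp add: set_mult_def)
  \<comment> \<open>The pair of the empty set and \<open>B\<close> has value 0. So \<open>?V\<close>
    is nonempty and its maximum is nonnegative, which makes \<open>nat (Max ?V)\<close> a faithful
    conversion.\<close>
  then have zero: "0 \<in> ?V" by force
  have "deficiency G A B \<le> nat (Max ?V)"
  proof (rule deficiency_le_of_card_le[OF assms(1-5,9)])
    fix S R assume "S \<subseteq> A" "R \<subseteq> B \<union> {\<one>\<^bsub>G\<^esub>}" "S <#>\<^bsub>G\<^esub> R = S"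
    then have "int (card S) - int (card (B - R)) \<le> Max ?V" by (intro Max_ge[OF fin]) blast
    then show "card S \<le> card (B - R) + nat (Max ?V)" by linarith
  qed
  moreover have "0 \<le> Max ?V" using fin zero by (rule Max_ge)
  ultimately show "int (deficiency G A B) \<le> Max ?V" by linarith
  show "Max ?V \<le> int (deficiency G A B)"
  proof (rule Max.boundedI[OF fin])
    fix v assume "v \<in> ?V"
    then obtain S R where "v = int (card S) - int (card (B - R))" "S \<subseteq> A" "S <#>\<^bsub>G\<^esub> R = S"
      by blast
    then show "v \<le> int (deficiency G A B)"
      using card_le_deficiency[OF assms(4,5), of S G R] by linarith
  qed (use zero in blast)
qed

end
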